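(* Let $k\ge 2$ and $\ell\ge 2$ be integers and $\varepsilon^{2\ell}=1$. The commutative monoid $\mathcal{P}^+_{\varepsilon,\xi}$ of dominant monomials is isomorphic (as a monoid) to the monoid $\mathrm{SSYT}(k,[k+\ell],\sim)$ of $\sim$-equivalence classes of semistandard Young tableaux.
   Context: **Dominant monomials.** Let $I=\{1,\dots,k-1\}$ be the vertex set of the Dynkin diagram of $\mathfrak{sl}_k$. Let $\mathcal{P}$ be the free abelian (multiplicative) group on formal variables $Y_{i,s}$, $i\in I$, $s\in\mathbb{Z}$, and let $\mathcal{P}^+$ be the submonoid generated by the $Y_{i,s}$. Let $\mathcal{P}^+_\varepsilon=\mathcal{P}^+/\!\sim$, where here $\sim$ is the smallest monoid congruence generated by $Y_{i,p}=Y_{i,p+2\ell}$ for all $i\in I$, $p\in\mathbb{Z}$. Put $\xi_i=0$ for $i$ odd and $\xi_i=1$ for $i$ even. Then $\mathcal{P}^+_{\varepsilon,\xi}$ is the submonoid of $\mathcal{P}^+_\varepsilon$ generated by the $Y_{i,s}$ with $i\in I$ and $s\equiv\xi_i \pmod 2$. **Tableaux.** For $k,n\ge1$ let $[n]=\{1,\dots,n\}$ and let $\mathrm{SSYT}(k,[n])$ be the set of rectangular semistandard Young tableaux (rows weakly increasing, columns strictly increasing) with $k$ rows, entries in $[n]$, and arbitrarily many columns, including the empty tableau $\mathbf{1}$. For $S,T\in\mathrm{SSYT}(k,[n])$ let $S\cup T$ be the row-increasing tableau whose $i$-th row is the union (as multisets) of the $i$-th rows of $S$ and $T$; it is again semistandard,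 so $\mathrm{SSYT}(k,[n])$ is a commutative monoid under $\cup$. A tableau is *trivial* if each entry is one less than the entry directly below it. For $T\in\mathrm{SSYT}(k,[n])$, $T_{\mathrm{red}}$ is the semistandard tableau obtained from $T$ by removing a maximal trivial factor with respect to $\cup$ (so $T_{\mathrm{red}}=\mathbf{1}$ if $T$ is trivial). Define $S\sim T$ if and only if $S_{\mathrm{red}}=T_{\mathrm{red}}$. Then $\mathrm{SSYT}(k,[n],\sim)$ denotes the set of $\sim$-equivalence classes, with the monoid structure induced by $\cup$. *)

theory Defs
  imports Complex_Main "HOL-Algebra.Free_Abelian_Groups" "HOL-Library.Multiset"
begin

section \<open>Submonoids and quotients of commutative monoids\<close>

definition submonoid_generated :: "('a, 'b) monoid_scheme \<Rightarrow> 'a set \<Rightarrow> ('a, 'b) monoid_scheme" where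
  "submonoid_generated M S = M\<lparr>carrier := \<Inter>{H. submonoid H M \<and> S \<subseteq> H}\<rparr>"

definition monoid_congruence :: "('a, 'b) monoid_scheme \<Rightarrow> ('a \<times> 'a) set \<Rightarrow> bool" where
  "monoid_congruence M R \<longleftrightarrow>
     equiv (carrier M) R \<and>
     (\<forall>(a, a') \<in> R. \<forall>(b, b') \<in> R. (a \<otimes>\<^bsub>M\<^esub> b, a' \<otimes>\<^bsub>M\<^esub> b') \<in> R)"

text \<open>Meaningful only for \<open>Q \<subseteq> carrier M \<times> carrier M\<close>; otherwise there is no such \<open>R\<close> and the result is \<^const>\<open>UNIV\<close>.\<close>
definition congruence_generated :: "('a, 'b) monoid_scheme \<Rightarrow> ('a \<times> 'a) set \<Rightarrow> ('a \<times> 'a) set" where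
  "congruence_generated M Q = \<Inter>{R. monoid_congruence M R \<and> Q \<subseteq> R}"

text \<open>The product of two classes is the class of the product of representatives. As usual with
  \<^const>\<open>quotient\<close>, this is written as a union over all representatives; if \<open>R\<close> is a
  congruence, all members of the union coincide.\<close>
definition quotient_monoid :: "('a, 'b) monoid_scheme \<Rightarrow> ('a \<times> 'a) set \<Rightarrow> 'a set monoid" where
  "quotient_monoid M R =
     \<lparr>carrier = carrier M // R,
      monoid.mult = (\<lambda>A B. \<Union>a\<in>A. \<Union>b\<in>B. R `` {a \<otimes>\<^bsub>M\<^esub> b}),
      one = R `` {\<one>\<^bsub>M\<^esub>}\<rparr>"


section \<open>Dominant monomials\<close>

text \<open>The variable \<open>Y\<^bsub>i,s\<^esub>\<close> is the generator \<open>frag_of (i, s)\<close>. The group operation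
  \<open>\<otimes>\<close> of \<^const>\<open>free_Abelian_group\<close> is addition of exponent vectors, i.e.\ multiplication
  of Laurent monomials.\<close>

abbreviation Yvar :: "nat \<Rightarrow> int \<Rightarrow> (nat \<times> int) \<Rightarrow>\<^sub>0 int" where
  "Yvar i s \<equiv> frag_of (i, s)"

definition vertices :: "nat \<Rightarrow> nat set" where
  "vertices k = {1..k - 1}"

definition monomials :: "nat \<Rightarrow> ((nat \<times> int) \<Rightarrow>\<^sub>0 int) monoid" where
  "monomials k = free_Abelian_group (vertices k \<times> UNIV)"

definition dominant_monomials :: "nat \<Rightarrow> ((nat \<times> int) \<Rightarrow>\<^sub>0 int) monoid" where
  "dominant_monomials k = submonoid_generated (monomials k) {Yvar i s |i s. i \<in> vertices k}"

definition eps_congruence ::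
    "nat \<Rightarrow> nat \<Rightarrow> (((nat \<times> int) \<Rightarrow>\<^sub>0 int) \<times> ((nat \<times> int) \<Rightarrow>\<^sub>0 int)) set" where
  "eps_congruence k l =
     congruence_generated (dominant_monomials k) {(Yvar i p, Yvar i (p + 2 * int l)) |i p. i \<in> vertices k}"

definition dominant_monomials_eps :: "nat \<Rightarrow> nat \<Rightarrow> ((nat \<times> int) \<Rightarrow>\<^sub>0 int) set monoid" where
  "dominant_monomials_eps k l = quotient_monoid (dominant_monomials k) (eps_congruence k l)"

definition xi :: "nat \<Rightarrow> int" where
  "xi i = (if odd i then 0 else 1)"

definition dominant_monomials_eps_xi :: "nat \<Rightarrow> nat \<Rightarrow> ((nat \<times> int) \<Rightarrow>\<^sub>0 int) set monoid" where
  "dominant_monomials_eps_xi k l =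
     submonoid_generated (dominant_monomials_eps k l)
       {eps_congruence k l `` {Yvar i s} |i s. i \<in> vertices k \<and> s mod 2 = xi i mod 2}"


section \<open>Semistandard Young tableaux\<close>

text \<open>A tableau is the list of its rows, from top to bottom. The empty tableau with \<open>k\<close> rows is a
  list of \<open>k\<close> empty rows.\<close>
type_synonym tableau = "nat list list"

definition SSYT :: "nat \<Rightarrow> nat \<Rightarrow> tableau set" where
  "SSYT k n =
     {T. length T = k \<and>
         (\<exists>m. \<forall>r \<in> set T. length r = m) \<and>
         (\<forall>r \<in> set T. set r \<subseteq> {1..n} \<and> sorted r) \<and>
         (\<forall>i j. Suc i < k \<longrightarrow> j < length (T ! i) \<longrightarrow> T ! i ! j < T ! Suc i ! j)}"

definition empty_tableau :: "nat \<Rightarrow> tableau" where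
  "empty_tableau k = replicate k []"

definition tableau_union :: "tableau \<Rightarrow> tableau \<Rightarrow> tableau" where
  "tableau_union S T = map2 (\<lambda>r s. sorted_list_of_multiset (mset r + mset s)) S T"

definition SSYT_monoid :: "nat \<Rightarrow> nat \<Rightarrow> tableau monoid" where
  "SSYT_monoid k n =
     \<lparr>carrier = SSYT k n, monoid.mult = tableau_union, one = empty_tableau k\<rparr>"

definition trivial_tableau :: "tableau \<Rightarrow> bool" where
  "trivial_tableau T \<longleftrightarrow>
     (\<forall>i j. Suc i < length T \<longrightarrow> j < length (T ! i) \<longrightarrow> T ! Suc i ! j = T ! i ! j + 1)"

definition tableau_factor :: "nat \<Rightarrow> nat \<Rightarrow> tableau \<Rightarrow> tableau \<Rightarrow> bool" where
  "tableau_factor k n S T \<longleftrightarrow> S \<in> SSYT k n \<and> (\<exists>U \<in> SSYT k n. T = tableau_union S U)"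

definition maximal_trivial_factor :: "nat \<Rightarrow> nat \<Rightarrow> tableau \<Rightarrow> tableau \<Rightarrow> bool" where
  "maximal_trivial_factor k n S T \<longleftrightarrow>
     tableau_factor k n S T \<and> trivial_tableau S \<and>
     (\<forall>S'. tableau_factor k n S' T \<and> trivial_tableau S' \<and> tableau_factor k n S S' \<longrightarrow> S' = S)"

text \<open>The maximal trivial factor and its complement are unique: a trivial tableau is determined by
  its first row, and for \<open>T\<close> with \<open>k\<close> rows the number of columns \<open>(a, a+1, \<dots>, a+k-1)\<close> in a maximal
  trivial factor is the minimum over \<open>i\<close> of the number of entries \<open>a+i-1\<close> in the \<open>i\<close>-th row of \<open>T\<close>.\<close>
definition reduced_tableau :: "nat \<Rightarrow> nat \<Rightarrow> tableau \<Rightarrow> tableau" where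
  "reduced_tableau k n T =
     (THE U. U \<in> SSYT k n \<and> (\<exists>S. maximal_trivial_factor k n S T \<and> T = tableau_union S U))"

definition tableau_equiv :: "nat \<Rightarrow> nat \<Rightarrow> (tableau \<times> tableau) set" where
  "tableau_equiv k n =
     {(S, T). S \<in> SSYT k n \<and> T \<in> SSYT k n \<and> reduced_tableau k n S = reduced_tableau k n T}"

definition SSYT_classes :: "nat \<Rightarrow> nat \<Rightarrow> tableau set monoid" where
  "SSYT_classes k n = quotient_monoid (SSYT_monoid k n) (tableau_equiv k n)"

end

theory Submission
  imports Defs
begin

text \<open>
  Both monoids are free commutative monoids on the same finite set \<open>free_indices k l\<close>, the pairs
  \<open>(i, r)\<close> with \<open>1 \<le> i < k\<close>, \<open>0 \<le> r < 2l\<close> and \<open>r \<equiv> \<xi>\<^sub>i (mod 2)\<close>; there are \<open>(k - 1) l\<close> of them.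

  For monomials this is a normal form argument: replacing each \<open>Y\<^bsub>i,p\<^esub>\<close> by \<open>Y\<^bsub>i,p mod 2l\<^esub>\<close> is an
  additive map on exponent vectors whose kernel is exactly the congruence
  (\<open>eps_congruence_kernel\<close>). The quotient is therefore free on the \<open>Y\<^bsub>i,r\<^esub>\<close> with \<open>0 \<le> r < 2l\<close>, and
  since \<open>2l\<close> is even the parity condition singles out a subset of these generators.

  For tableaux, number the rows from \<open>0\<close> and let \<open>ht T i c\<close> be the number of entries \<open>\<le> c + i\<close>
  in row \<open>i\<close>. These numbers determine \<open>T\<close> and turn \<open>\<union>\<close> into addition. In them, columns are strictly
  increasing iff \<open>ht T (i + 1) c \<le> ht T i c\<close> for all \<open>c\<close>, and \<open>T\<close> is trivial iff all the rows
  have the same \<open>ht\<close>. The differences \<open>ht T i c - ht T (i + 1) c\<close> with \<open>1 \<le> c \<le> l\<close> thus form a vector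
  \<open>coords k l T\<close> of \<open>(k - 1) l\<close> natural numbers that depends additively on \<open>T\<close> and does not see trivial
  factors. Two further facts show that it identifies the classes with all such vectors.

  First, equal differences force \<open>S \<sim> T\<close> (\<open>tableau_equiv_kernel\<close>). The maximal trivial factor of \<open>T\<close>
  takes, for each \<open>c\<close>, as many columns as the smallest of the increments
  \<open>ht T i (c + 1) - ht T i c\<close> over all rows \<open>i\<close>. If \<open>S\<close> and \<open>T\<close> have equal differences, their \<open>ht\<close>
  differ by a function of \<open>c\<close> alone, which shifts these minima by the same amount and so disappears
  when the trivial factor is removed.

  Second, every vector occurs (\<open>coords_surj\<close>). Prescribed differences fix \<open>ht\<close> up to a function of
  \<open>c\<close> common to all rows, and a sufficiently steep such function makes all the rows monotone.
\<close>

section \<open>Kernels and generated submonoids\<close>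

text \<open>The laws are pulled back along the injective map \<open>h\<close>. For a quotient this is shorter than
  computing with representatives.\<close>
lemma comm_monoid_of_iso:
  assumes "comm_monoid N" and h: "h \<in> iso Q N"
    and cl: "\<And>x y. x \<in> carrier Q \<Longrightarrow> y \<in> carrier Q \<Longrightarrow> x \<otimes>\<^bsub>Q\<^esub> y \<in> carrier Q"
    and one: "\<one>\<^bsub>Q\<^esub> \<in> carrier Q" "h \<one>\<^bsub>Q\<^esub> = \<one>\<^bsub>N\<^esub>"
  shows "comm_monoid Q"
proof -
  interpret N: comm_monoid N by fact
  have mult: "h (x \<otimes>\<^bsub>Q\<^esub> y) = h x \<otimes>\<^bsub>N\<^esub> h y" if "x \<in> carrier Q" "y \<in> carrier Q" for x y
    using h that by (simp add: iso_def hom_def)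
  have in_N: "h x \<in> carrier N" if "x \<in> carrier Q" for x
    using h that by (auto simp: iso_def hom_def)
  have inj: "x = y" if "h x = h y" "x \<in> carrier Q" "y \<in> carrier Q" for x y
    using h that by (auto simp: iso_iff dest: inj_onD)
  show ?thesis
    by (rule comm_monoidI; (rule cl one inj)?) (auto simp: cl one mult in_N N.m_ac)
qed

text \<open>The inverse of \<open>f\<close> is a homomorphism because \<open>H\<close> is closed under multiplication.\<close>
lemma is_iso_common_target:
  assumes "h \<in> iso G K" "f \<in> iso H K" "comm_monoid H"
  shows "G \<cong> H"
proof -
  interpret H: comm_monoid H by fact
  let ?g = "inv_into (carrier H) f"
  have inj: "inj_on f (carrier H)" and im: "f ` carrier H = carrier K" and fh: "f \<in> hom H K"
    using assms(2) by (auto simp: iso_iff)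
  have bij: "bij_betw ?g (carrier K) (carrier H)"
    using assms(2) by (simp add: iso_def bij_betw_inv_into)
  have "?g (x \<otimes>\<^bsub>K\<^esub> y) = ?g x \<otimes>\<^bsub>H\<^esub> ?g y" if "x \<in> carrier K" "y \<in> carrier K" for x y
  proof -
    from that have "x \<in> f ` carrier H" "y \<in> f ` carrier H" by (simp_all add: im)
    then obtain u v where uv: "u \<in> carrier H" "v \<in> carrier H" "x = f u" "y = f v" by auto
    then have "x \<otimes>\<^bsub>K\<^esub> y = f (u \<otimes>\<^bsub>H\<^esub> v)" using fh by (simp add: hom_def)
    then show ?thesis using uv inj by (simp add: inv_into_f_f)
  qed
  then have "?g \<in> iso K H"
    using bij by (auto simp: iso_def hom_def dest: bij_betwE)
  then have "?g \<circ> h \<in> iso G H"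
    using assms(1) by (rule iso_set_trans[rotated])
  then show ?thesis by (rule is_isoI)
qed

text \<open>The first isomorphism theorem. The induced map sends a class to the value of \<open>f\<close> that all its members
  share. The product of classes is a single class because \<open>f\<close> of a product depends only on \<open>f\<close> of
  the factors, and the laws of the quotient are inherited from \<open>N\<close>.\<close>
lemma quotient_by_kernel:
  assumes N: "comm_monoid N"
    and cl: "\<And>x y. x \<in> carrier M \<Longrightarrow> y \<in> carrier M \<Longrightarrow> x \<otimes>\<^bsub>M\<^esub> y \<in> carrier M"
    and one: "\<one>\<^bsub>M\<^esub> \<in> carrier M" "f \<one>\<^bsub>M\<^esub> = \<one>\<^bsub>N\<^esub>"
    and f: "f \<in> hom M N" "f ` carrier M = carrier N"
    and R: "R = {(a, b). a \<in> carrier M \<and> b \<in> carrier M \<and> f a = f b}"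
  obtains h where "h \<in> iso (quotient_monoid M R) N"
    "h \<one>\<^bsub>quotient_monoid M R\<^esub> = \<one>\<^bsub>N\<^esub>"
    "\<And>x. x \<in> carrier M \<Longrightarrow> h (R `` {x}) = f x"
    "comm_monoid (quotient_monoid M R)"
proof
  let ?Q = "quotient_monoid M R"
  define h where "h = (\<lambda>X. the_elem (f ` X))"
  have h: "h (R `` {x}) = f x" if "x \<in> carrier M" for x
  proof -
    have "f ` (R `` {x}) = {f x}" using that R by auto
    then show ?thesis by (simp add: h_def)
  qed
  have fm: "f (x \<otimes>\<^bsub>M\<^esub> y) = f x \<otimes>\<^bsub>N\<^esub> f y" if "x \<in> carrier M" "y \<in> carrier M" for x y
    using f that by (simp add: hom_def)
  have carrier: "carrier ?Q = {R `` {x} |x. x \<in> carrier M}"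
    by (auto simp: quotient_monoid_def quotient_def)
  have cls: "R `` {x} = {y \<in> carrier M. f y = f x}" if "x \<in> carrier M" for x
    using that R by auto
  have mult: "R `` {x} \<otimes>\<^bsub>?Q\<^esub> R `` {y} = R `` {x \<otimes>\<^bsub>M\<^esub> y}"
    if "x \<in> carrier M" "y \<in> carrier M" for x y
  proof -
    have const: "R `` {a \<otimes>\<^bsub>M\<^esub> b} = R `` {x \<otimes>\<^bsub>M\<^esub> y}" if "a \<in> R `` {x}" "b \<in> R `` {y}" for a b
      using that \<open>x \<in> carrier M\<close> \<open>y \<in> carrier M\<close> by (simp add: cls cl fm)
    have ne: "x \<in> R `` {x}" "y \<in> R `` {y}" using that by (simp_all add: cls)
    have "(\<Union>b\<in>R `` {y}. R `` {a \<otimes>\<^bsub>M\<^esub> b}) = R `` {x \<otimes>\<^bsub>M\<^esub> y}" if "a \<in> R `` {x}" for a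
      by (rule UN_constant_eq[OF ne(2)]) (use const that in blast)
    then have "(\<Union>a\<in>R `` {x}. \<Union>b\<in>R `` {y}. R `` {a \<otimes>\<^bsub>M\<^esub> b}) = R `` {x \<otimes>\<^bsub>M\<^esub> y}"
      by (intro UN_constant_eq[OF ne(1)] ballI)
    then show ?thesis by (simp add: quotient_monoid_def)
  qed
  have clQ: "X \<otimes>\<^bsub>?Q\<^esub> Y \<in> carrier ?Q" if "X \<in> carrier ?Q" "Y \<in> carrier ?Q" for X Y
    using that mult cl unfolding carrier by blast
  have oneQ: "\<one>\<^bsub>?Q\<^esub> = R `` {\<one>\<^bsub>M\<^esub>}" by (simp add: quotient_monoid_def)
  show "h (R `` {x}) = f x" if "x \<in> carrier M" for x by (fact h[OF that])
  show hone: "h \<one>\<^bsub>?Q\<^esub> = \<one>\<^bsub>N\<^esub>" using one by (simp add: oneQ h)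
  have "h \<in> hom ?Q N"
    using f(1) by (auto simp: hom_def carrier mult h cl fm)
  moreover have "h ` carrier ?Q = carrier N"
  proof -
    have "h ` carrier ?Q = (\<lambda>x. h (R `` {x})) ` carrier M" unfolding carrier by blast
    then show ?thesis using f(2) by (simp add: h)
  qed
  moreover have "inj_on h (carrier ?Q)"
  proof (rule inj_onI)
    fix X Y assume "X \<in> carrier ?Q" "Y \<in> carrier ?Q" and eq: "h X = h Y"
    then obtain x y where xy: "x \<in> carrier M" "y \<in> carrier M" and XY: "X = R `` {x}" "Y = R `` {y}"
      unfolding carrier by blast
    with eq have "f x = f y" by (simp add: h)
    then show "X = Y" using xy by (simp add: XY cls)
  qed
  ultimately show iso: "h \<in> iso ?Q N" by (simp add: iso_iff)
  have "\<one>\<^bsub>?Q\<^esub> \<in> carrier ?Q" unfolding oneQ carrier using one(1) by blast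
  then show "comm_monoid ?Q" using comm_monoid_of_iso[OF N iso clQ _ hone] by blast
qed

lemma submonoid_generated_submonoid:
  assumes "comm_monoid M" "S \<subseteq> carrier M"
  shows "submonoid (carrier (submonoid_generated M S)) M"
proof -
  interpret comm_monoid M by fact
  have "submonoid (carrier M) M" by unfold_locales auto
  with assms(2) show ?thesis
    by (auto simp: submonoid_generated_def submonoid_def)
qed

lemma submonoid_generated_superset: "S \<subseteq> carrier (submonoid_generated M S)"
  by (auto simp: submonoid_generated_def)

lemma submonoid_generated_least:
  assumes "submonoid H M" "S \<subseteq> H"
  shows "carrier (submonoid_generated M S) \<subseteq> H"
  using assms by (auto simp: submonoid_generated_def)

lemma comm_monoid_submonoid_generated:
  assumes "comm_monoid M" "S \<subseteq> carrier M"
  shows "comm_monoid (submonoid_generated M S)"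
  using comm_monoid.submonoid_is_comm_monoid[OF assms(1) submonoid_generated_submonoid[OF assms]]
  by (simp add: submonoid_generated_def)

text \<open>Each inclusion between \<open>h\<close> of the submonoid generated by \<open>S\<close> and the submonoid generated by
  \<open>h ` S\<close> follows from minimality, applied to the image and to the preimage under \<open>h\<close> of the other
  submonoid.\<close>
lemma iso_submonoid_generated:
  assumes "comm_monoid Q" "comm_monoid N" and h: "h \<in> iso Q N" "h \<one>\<^bsub>Q\<^esub> = \<one>\<^bsub>N\<^esub>"
    and S: "S \<subseteq> carrier Q"
  shows "h \<in> iso (submonoid_generated Q S) (submonoid_generated N (h ` S))"
proof -
  interpret Q: comm_monoid Q by fact
  interpret N: comm_monoid N by fact
  let ?G = "carrier (submonoid_generated Q S)" and ?G' = "carrier (submonoid_generated N (h ` S))"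
  have hom: "h \<in> hom Q N" and im: "h ` carrier Q = carrier N" and inj: "inj_on h (carrier Q)"
    using h by (auto simp: iso_iff)
  interpret G: submonoid ?G Q
    by (rule submonoid_generated_submonoid[OF assms(1) S])
  interpret G': submonoid ?G' N
    by (rule submonoid_generated_submonoid[OF assms(2)]) (use S im in auto)
  have hm: "h (x \<otimes>\<^bsub>Q\<^esub> y) = h x \<otimes>\<^bsub>N\<^esub> h y" if "x \<in> carrier Q" "y \<in> carrier Q" for x y
    using hom that by (simp add: hom_def)
  have "submonoid (h ` ?G) N"
  proof
    show "h ` ?G \<subseteq> carrier N" using G.subset im by auto
    show "\<one>\<^bsub>N\<^esub> \<in> h ` ?G" by (rule image_eqI[where x = "\<one>\<^bsub>Q\<^esub>"]) (simp_all add: h(2))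
    fix x y assume "x \<in> h ` ?G" "y \<in> h ` ?G"
    then obtain u v where "u \<in> ?G" "v \<in> ?G" "x = h u" "y = h v" by auto
    then show "x \<otimes>\<^bsub>N\<^esub> y \<in> h ` ?G"
      using hm[of u v] G.m_closed[of u v] by (metis G.mem_carrier imageI)
  qed
  then have 1: "?G' \<subseteq> h ` ?G"
    by (rule submonoid_generated_least) (rule image_mono[OF submonoid_generated_superset])
  have "submonoid {x \<in> carrier Q. h x \<in> ?G'} Q"
    by standard (use hm h(2) in auto)
  then have "?G \<subseteq> {x \<in> carrier Q. h x \<in> ?G'}"
    by (rule submonoid_generated_least)
       (use submonoid_generated_superset[of "h ` S" N] S in auto)
  then have 2: "h ` ?G \<subseteq> ?G'" by auto
  have "inj_on h ?G" by (rule inj_on_subset[OF inj G.subset])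
  moreover have "h \<in> hom (submonoid_generated Q S) (submonoid_generated N (h ` S))"
    using 2 hm G.subset by (auto simp: hom_def submonoid_generated_def)
  ultimately show ?thesis using 1 2 by (auto simp: iso_iff)
qed


section \<open>Free commutative monoids\<close>

text \<open>Elements are exponent vectors; integer coefficients keep this inside the type that carries
  \<^const>\<open>free_Abelian_group\<close>.\<close>
definition free_comm_monoid :: "'a set \<Rightarrow> ('a \<Rightarrow>\<^sub>0 int) monoid" where
  "free_comm_monoid A =
     \<lparr>carrier = {c. Poly_Mapping.keys c \<subseteq> A \<and> (\<forall>x. 0 \<le> Poly_Mapping.lookup c x)},
      monoid.mult = (+), one = 0\<rparr>"

lemma mem_free_comm_monoid:
  "c \<in> carrier (free_comm_monoid A) \<longleftrightarrow>
     (\<forall>x. 0 \<le> Poly_Mapping.lookup c x \<and> (x \<notin> A \<longrightarrow> Poly_Mapping.lookup c x = 0))"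
  by (auto simp: free_comm_monoid_def in_keys_iff)

lemma free_comm_monoid_simps [simp]:
  "x \<otimes>\<^bsub>free_comm_monoid A\<^esub> y = x + y" "\<one>\<^bsub>free_comm_monoid A\<^esub> = 0"
  by (simp_all add: free_comm_monoid_def)

lemma comm_monoid_free_comm_monoid: "comm_monoid (free_comm_monoid A)"
  by (rule comm_monoidI) (auto simp: mem_free_comm_monoid lookup_add algebra_simps)

lemma frag_of_in_free_comm_monoid: "frag_of a \<in> carrier (free_comm_monoid A) \<longleftrightarrow> a \<in> A"
  by (auto simp: mem_free_comm_monoid)

text \<open>Nonnegativity of the coefficients is what makes sums of generators suffice, without differences.\<close>
lemma free_comm_monoid_induct [consumes 1, case_names zero frag_of add]:
  assumes c: "c \<in> carrier (free_comm_monoid A)"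
    and zero: "P 0" and gen: "\<And>a. a \<in> A \<Longrightarrow> P (frag_of a)"
    and add: "\<And>x y. P x \<Longrightarrow> P y \<Longrightarrow> P (x + y)"
  shows "P c"
proof -
  have multiple: "P (frag_cmul (int n) (frag_of a))" if "a \<in> A" for n a
    by (induction n) (auto simp: zero frag_cmul_distrib intro: add gen that)
  have "P (\<Sum>a\<in>F. frag_cmul (Poly_Mapping.lookup c a) (frag_of a))" if "F \<subseteq> Poly_Mapping.keys c" "finite F" for F
    using that(2,1)
  proof (induction F)
    case (insert a F)
    have "Poly_Mapping.lookup c a = int (nat (Poly_Mapping.lookup c a))" "a \<in> A"
      using c insert.prems by (auto simp: mem_free_comm_monoid in_keys_iff)
    then have "P (frag_cmul (Poly_Mapping.lookup c a) (frag_of a))"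
      using multiple by metis
    with insert show ?case by (auto intro: add)
  qed (simp add: zero)
  from this[OF subset_refl finite_keys] show ?thesis
    using frag_expansion[of c] by (simp add: frag_extend_def)
qed

lemma submonoid_generated_frag_of:
  fixes M :: "('a \<Rightarrow>\<^sub>0 int) monoid"
  assumes M: "monoid.mult M = (+)" "one M = 0"
    and sub: "carrier (free_comm_monoid A) \<subseteq> carrier M"
  shows "submonoid_generated M (frag_of ` A) = free_comm_monoid A"
proof -
  have "submonoid (carrier (free_comm_monoid A)) M"
    by standard (use sub M in \<open>auto simp: mem_free_comm_monoid lookup_add\<close>)
  then have "carrier (submonoid_generated M (frag_of ` A)) \<subseteq> carrier (free_comm_monoid A)"
    by (rule submonoid_generated_least) (auto simp: frag_of_in_free_comm_monoid)
  moreover have "c \<in> H" if "c \<in> carrier (free_comm_monoid A)" "submonoid H M" "frag_of ` A \<subseteq> H" for c H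
    using that(1)
  proof (induction rule: free_comm_monoid_induct)
    case zero then show ?case using submonoid.one_closed[OF that(2)] M by simp
  next
    case (add x y) then show ?case using submonoid.m_closed[OF that(2), of x y] M by simp
  qed (use that in auto)
  ultimately have "carrier (submonoid_generated M (frag_of ` A)) = carrier (free_comm_monoid A)"
    by (auto simp: submonoid_generated_def)
  then show ?thesis
    using M by (simp add: submonoid_generated_def free_comm_monoid_def)
qed


section \<open>Dominant monomials\<close>

lemma dominant_monomials_free: "dominant_monomials k = free_comm_monoid (vertices k \<times> UNIV)"
proof -
  have "{Yvar i s |i s. i \<in> vertices k} = frag_of ` (vertices k \<times> UNIV)" by auto
  moreover have "submonoid_generated (free_Abelian_group (vertices k \<times> UNIV)) (frag_of ` (vertices k \<times> UNIV))
      = free_comm_monoid (vertices k \<times> UNIV)"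
    by (rule submonoid_generated_frag_of) (auto simp: free_Abelian_group_def free_comm_monoid_def)
  ultimately show ?thesis by (simp add: dominant_monomials_def monomials_def)
qed

text \<open>The substitution \<open>Y\<^bsub>i,p\<^esub> \<mapsto> Y\<^bsub>i,p mod 2l\<^esub>\<close>, which picks a normal form in each congruence class.\<close>
definition reduce_index :: "nat \<Rightarrow> ((nat \<times> int) \<Rightarrow>\<^sub>0 int) \<Rightarrow> ((nat \<times> int) \<Rightarrow>\<^sub>0 int)" where
  "reduce_index l = frag_extend (\<lambda>(i, p). Yvar i (p mod (2 * int l)))"

lemma reduce_index_simps [simp]:
  "reduce_index l 0 = 0"
  "reduce_index l (x + y) = reduce_index l x + reduce_index l y"
  "reduce_index l (Yvar i p) = Yvar i (p mod (2 * int l))"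
  by (simp_all add: reduce_index_def frag_extend_add)

lemma reduce_index_image:
  assumes "l > 0"
  shows "reduce_index l ` carrier (free_comm_monoid (V \<times> UNIV))
         = carrier (free_comm_monoid (V \<times> {0..<2 * int l}))"
proof (intro equalityI subsetI)
  fix y assume "y \<in> reduce_index l ` carrier (free_comm_monoid (V \<times> UNIV))"
  then obtain x where "x \<in> carrier (free_comm_monoid (V \<times> UNIV))" "y = reduce_index l x" by auto
  moreover from this(1) have "reduce_index l x \<in> carrier (free_comm_monoid (V \<times> {0..<2 * int l}))"
  proof (induction rule: free_comm_monoid_induct)
    case (frag_of a) then show ?case using assms by (cases a) (auto simp: frag_of_in_free_comm_monoid)
  qed (auto simp: mem_free_comm_monoid lookup_add)
  ultimately show "y \<in> carrier (free_comm_monoid (V \<times> {0..<2 * int l}))" by simp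
next
  fix y assume y: "y \<in> carrier (free_comm_monoid (V \<times> {0..<2 * int l}))"
  then have "reduce_index l y = y"
    by (induction rule: free_comm_monoid_induct) (auto simp: case_prod_beta)
  moreover have "y \<in> carrier (free_comm_monoid (V \<times> UNIV))"
    using y by (auto simp: mem_free_comm_monoid)
  ultimately show "y \<in> reduce_index l ` carrier (free_comm_monoid (V \<times> UNIV))" by (metis imageI)
qed

text \<open>Transitivity iterates the generating relation upwards; for an index below its residue, the residue is
  reached upwards, and for one above it the relation is read backwards.\<close>
lemma congruence_contains_shifts:
  assumes R: "monoid_congruence (dominant_monomials k) R"
    and Q: "{(Yvar i p, Yvar i (p + 2 * int l)) |i p. i \<in> vertices k} \<subseteq> R"
    and i: "i \<in> vertices k"
  shows "(Yvar i p, Yvar i (p mod (2 * int l))) \<in> R"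
proof -
  have "equiv (carrier (dominant_monomials k)) R" using R by (simp add: monoid_congruence_def)
  then have eq: "refl_on (carrier (dominant_monomials k)) R" "sym R" "trans R"
    by (auto simp: equiv_def)
  have up: "(Yvar i p, Yvar i (p + 2 * int l * int m)) \<in> R" for p m
  proof (induction m)
    case 0
    show ?case using eq(1) i
      by (auto simp: refl_on_def dominant_monomials_free frag_of_in_free_comm_monoid)
  next
    case (Suc m)
    have "(Yvar i (p + 2 * int l * int m), Yvar i (p + 2 * int l * int m + 2 * int l)) \<in> R"
      using Q i by blast
    with Suc show ?case using transD[OF eq(3)] by (simp add: algebra_simps)
  qed
  let ?q = "p div (2 * int l)"
  have p: "p = p mod (2 * int l) + 2 * int l * ?q" by simp
  show ?thesis
  proof (cases "?q \<ge> 0")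
    case True
    have "(Yvar i (p mod (2 * int l)), Yvar i p) \<in> R"
      using up[of "p mod (2 * int l)" "nat ?q"] True p by simp
    then show ?thesis using symD[OF eq(2)] by blast
  next
    case False
    then have "p mod (2 * int l) = p + 2 * int l * int (nat (- ?q))"
      using p by (simp add: algebra_simps minus_div_mult_eq_mod)
    then show ?thesis using up[of p "nat (- ?q)"] by simp
  qed
qed

text \<open>The kernel is a congruence that contains the generating pairs. Conversely, any such congruence relates
  each generator, hence by induction each monomial, to its normal form, so two monomials with the same
  normal form are related.\<close>
lemma eps_congruence_kernel:
  "eps_congruence k l =
     {(a, b). a \<in> carrier (dominant_monomials k) \<and> b \<in> carrier (dominant_monomials k) \<and>
              reduce_index l a = reduce_index l b}" (is "_ = ?K")
proof
  let ?D = "dominant_monomials k"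
  have D: "a \<otimes>\<^bsub>?D\<^esub> b = a + b" for a b by (simp add: dominant_monomials_free)
  have add: "a + b \<in> carrier ?D" if "a \<in> carrier ?D" "b \<in> carrier ?D" for a b
    using that by (auto simp: dominant_monomials_free mem_free_comm_monoid lookup_add)
  have "equiv (carrier ?D) ?K"
    by (auto simp: equiv_def refl_on_def sym_def trans_def)
  then have "monoid_congruence ?D ?K"
    by (auto simp: monoid_congruence_def D add)
  moreover have "{(Yvar i p, Yvar i (p + 2 * int l)) |i p. i \<in> vertices k} \<subseteq> ?K"
    by (auto simp: dominant_monomials_free frag_of_in_free_comm_monoid)
  ultimately show "eps_congruence k l \<subseteq> ?K"
    by (auto simp only: eps_congruence_def congruence_generated_def)
  show "?K \<subseteq> eps_congruence k l"
    unfolding eps_congruence_def congruence_generated_def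
  proof (clarify)
    fix a b R
    assume ab: "a \<in> carrier ?D" "b \<in> carrier ?D" "reduce_index l a = reduce_index l b"
      and R: "monoid_congruence ?D R"
      and Q: "{(Yvar i p, Yvar i (p + 2 * int l)) |i p. i \<in> vertices k} \<subseteq> R"
    have eq: "refl_on (carrier ?D) R" "sym R" "trans R"
      using R by (auto simp: equiv_def monoid_congruence_def)
    have cong: "(x + x', y + y') \<in> R" if "(x, y) \<in> R" "(x', y') \<in> R" for x y x' y'
      using R that unfolding monoid_congruence_def D by blast
    have "(c, reduce_index l c) \<in> R" if "c \<in> carrier ?D" for c
      using that unfolding dominant_monomials_free
    proof (induction rule: free_comm_monoid_induct)
      case zero
      have "0 \<in> carrier ?D" by (simp add: dominant_monomials_free mem_free_comm_monoid)
      then show ?case using eq(1) by (simp add: refl_on_def)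
    next
      case (frag_of a)
      then show ?case using congruence_contains_shifts[OF R Q] by (cases a) auto
    qed (auto intro: cong)
    from this[OF ab(1)] this[OF ab(2)] ab(3) show "(a, b) \<in> R"
      using symD[OF eq(2)] transD[OF eq(3)] by metis
  qed
qed

definition free_indices :: "nat \<Rightarrow> nat \<Rightarrow> (nat \<times> int) set" where
  "free_indices k l = {(i, r). i \<in> vertices k \<and> 0 \<le> r \<and> r < 2 * int l \<and> r mod 2 = xi i}"

text \<open>Reduction modulo \<open>2l\<close> preserves parity, so the classes that generate the submonoid correspond exactly
  to the variables in \<open>free_indices k l\<close>.\<close>
lemma dominant_monomials_eps_xi_free:
  assumes "l > 0"
  obtains h where "h \<in> iso (dominant_monomials_eps_xi k l) (free_comm_monoid (free_indices k l))"
    and "comm_monoid (dominant_monomials_eps_xi k l)"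
proof -
  let ?D = "dominant_monomials k" and ?E = "eps_congruence k l"
  let ?N = "free_comm_monoid (vertices k \<times> {0..<2 * int l})"
  have N: "comm_monoid ?N" by (rule comm_monoid_free_comm_monoid)
  interpret D: comm_monoid ?D
    unfolding dominant_monomials_free by (rule comm_monoid_free_comm_monoid)
  have image: "reduce_index l ` carrier ?D = carrier ?N"
    unfolding dominant_monomials_free by (rule reduce_index_image[OF assms])
  have one: "reduce_index l \<one>\<^bsub>?D\<^esub> = \<one>\<^bsub>?N\<^esub>" by (simp add: dominant_monomials_free)
  have hom: "reduce_index l \<in> hom ?D ?N"
    using image by (auto simp: hom_def dominant_monomials_free)
  obtain h where h: "h \<in> iso (dominant_monomials_eps k l) ?N"
      "h \<one>\<^bsub>dominant_monomials_eps k l\<^esub> = \<one>\<^bsub>?N\<^esub>"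
      "\<And>x. x \<in> carrier ?D \<Longrightarrow> h (?E `` {x}) = reduce_index l x"
      "comm_monoid (dominant_monomials_eps k l)"
    unfolding dominant_monomials_eps_def
    using quotient_by_kernel[OF N D.m_closed D.one_closed one hom image eps_congruence_kernel]
    by metis
  define S where "S = {?E `` {Yvar i s} |i s. i \<in> vertices k \<and> s mod 2 = xi i mod 2}"
  have Y: "Yvar i s \<in> carrier ?D" if "i \<in> vertices k" for i s
    using that by (simp add: dominant_monomials_free frag_of_in_free_comm_monoid)
  then have S: "S \<subseteq> carrier (dominant_monomials_eps k l)"
    by (auto simp: S_def dominant_monomials_eps_def quotient_monoid_def quotient_def)
  have hY: "h (?E `` {Yvar i s}) = Yvar i (s mod (2 * int l))" if "i \<in> vertices k" for i s
    using h(3) Y that by simp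
  have parity: "s mod (2 * int l) mod 2 = s mod 2" for s by (simp add: mod_mod_cancel)
  have xi: "xi i mod 2 = xi i" for i by (simp add: xi_def)
  have "h ` S = frag_of ` free_indices k l"
  proof (intro equalityI subsetI)
    fix y assume "y \<in> h ` S"
    then obtain i s where "i \<in> vertices k" "s mod 2 = xi i" "y = Yvar i (s mod (2 * int l))"
      by (auto simp: S_def hY xi)
    then show "y \<in> frag_of ` free_indices k l"
      using assms parity by (auto simp: free_indices_def)
  next
    fix y assume "y \<in> frag_of ` free_indices k l"
    then obtain i r where ir: "i \<in> vertices k" "0 \<le> r" "r < 2 * int l" "r mod 2 = xi i" "y = Yvar i r"
      by (auto simp: free_indices_def)
    then have "y = h (?E `` {Yvar i r})" by (simp add: hY)
    then show "y \<in> h ` S" using ir xi by (auto simp: S_def)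
  qed
  moreover have "submonoid_generated ?N (frag_of ` free_indices k l) = free_comm_monoid (free_indices k l)"
    by (rule submonoid_generated_frag_of)
       (auto simp: free_comm_monoid_def free_indices_def)
  ultimately have "h \<in> iso (dominant_monomials_eps_xi k l) (free_comm_monoid (free_indices k l))"
    using iso_submonoid_generated[OF h(4) N h(1,2) S] by (simp add: dominant_monomials_eps_xi_def S_def)
  moreover have "comm_monoid (dominant_monomials_eps_xi k l)"
    using comm_monoid_submonoid_generated[OF h(4) S] by (simp add: dominant_monomials_eps_xi_def S_def)
  ultimately show ?thesis by (rule that)
qed

section \<open>Height profiles of tableaux\<close>

text \<open>The shift by the row number \<open>i\<close> is chosen such that strict increase down the columns becomes a plain
  inequality between \<open>ht T (Suc i)\<close> and \<open>ht T i\<close>, and a trivial tableau has the same \<open>ht\<close> in every row.\<close>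
definition ht :: "tableau \<Rightarrow> nat \<Rightarrow> nat \<Rightarrow> int" where
  "ht T i c = int (length (filter (\<lambda>x. x \<le> c + i) (T ! i)))"

text \<open>The functions of the form \<^term>\<open>ht T\<close> for semistandard \<open>T\<close> with \<open>k\<close> rows and entries up to \<open>k + l\<close>.
  Row \<open>i\<close> of such a tableau has all its entries between \<open>i + 1\<close> and \<open>i + 1 + l\<close>, hence the value \<open>0\<close> at
  \<open>c = 0\<close> and the constant value, the common row length, for \<open>c > l\<close>.\<close>
definition profile :: "nat \<Rightarrow> nat \<Rightarrow> (nat \<Rightarrow> nat \<Rightarrow> int) \<Rightarrow> bool" where
  "profile k l h \<longleftrightarrow>
     (\<forall>i<k. h i 0 = 0 \<and> mono (h i)) \<and>
     (\<forall>i c. Suc i < k \<longrightarrow> h (Suc i) c \<le> h i c) \<and>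
     (\<exists>m. \<forall>i<k. \<forall>c>l. h i c = m)"

lemma profileI:
  assumes "\<And>i. i < k \<Longrightarrow> h i 0 = 0" "\<And>i c. i < k \<Longrightarrow> h i c \<le> h i (Suc c)"
    and "\<And>i c. Suc i < k \<Longrightarrow> h (Suc i) c \<le> h i c"
    and "\<And>i c. i < k \<Longrightarrow> l < c \<Longrightarrow> h i c = m"
  shows "profile k l h"
  unfolding profile_def mono_iff_le_Suc
  by (intro conjI allI impI exI[where x = m]) (simp_all add: assms)

lemma profileD:
  assumes "profile k l h"
  shows "i < k \<Longrightarrow> h i 0 = 0" "i < k \<Longrightarrow> c \<le> d \<Longrightarrow> h i c \<le> h i d"
    "Suc i < k \<Longrightarrow> h (Suc i) c \<le> h i c"
    "i < k \<Longrightarrow> j < k \<Longrightarrow> l < c \<Longrightarrow> l < d \<Longrightarrow> h i c = h j d"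
proof -
  obtain m where m: "\<forall>i<k. h i 0 = 0 \<and> mono (h i)" "\<forall>i c. Suc i < k \<longrightarrow> h (Suc i) c \<le> h i c"
    "\<forall>i<k. \<forall>c>l. h i c = m"
    using assms unfolding profile_def by blast
  show "i < k \<Longrightarrow> h i 0 = 0" "i < k \<Longrightarrow> c \<le> d \<Longrightarrow> h i c \<le> h i d"
    "Suc i < k \<Longrightarrow> h (Suc i) c \<le> h i c"
    "i < k \<Longrightarrow> j < k \<Longrightarrow> l < c \<Longrightarrow> l < d \<Longrightarrow> h i c = h j d"
    using m by (simp_all add: monoD)
qed

lemma profile_cong:
  assumes "profile k l g" "\<And>i c. i < k \<Longrightarrow> h i c = g i c"
  shows "profile k l h"
  using assms(1) unfolding profile_def mono_iff_le_Suc by (simp add: assms(2) Suc_lessD)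

lemma profile_add:
  assumes "profile k l g" "profile k l h"
  shows "profile k l (\<lambda>i c. g i c + h i c)"
proof (rule profileI)
  fix i c assume i: "i < k"
  show "g i 0 + h i 0 = 0" using profileD(1)[OF assms(1) i] profileD(1)[OF assms(2) i] by simp
  show "g i c + h i c \<le> g i (Suc c) + h i (Suc c)"
    using profileD(2)[OF assms(1) i, of c "Suc c"] profileD(2)[OF assms(2) i, of c "Suc c"] by simp
  show "g i c + h i c = g 0 (Suc l) + h 0 (Suc l)" if "l < c"
    using profileD(4)[OF assms(1) i _ that, of 0 "Suc l"]
      profileD(4)[OF assms(2) i _ that, of 0 "Suc l"] i by simp
next
  fix i c assume i: "Suc i < k"
  show "g (Suc i) c + h (Suc i) c \<le> g i c + h i c"
    using profileD(3)[OF assms(1) i] profileD(3)[OF assms(2) i] by (simp add: add_mono)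
qed

text \<open>In a sorted list the elements up to \<open>v\<close> form an initial segment. This translates between the entries of
  a row and its counting function.\<close>
lemma nth_le_iff_less_count:
  "sorted xs \<Longrightarrow> j < length xs \<Longrightarrow> xs ! j \<le> v \<longleftrightarrow> j < length (filter (\<lambda>x. x \<le> v) xs)"
  for xs :: "nat list"
proof (induction xs arbitrary: j)
  case (Cons a xs)
  show ?case
  proof (cases "a \<le> v")
    case True
    then show ?thesis using Cons by (cases j) auto
  next
    case False
    then have none: "filter (\<lambda>x. x \<le> v) (a # xs) = []" using Cons.prems(1) by (auto simp: filter_empty_conv)
    have "a \<le> (a # xs) ! j" using Cons.prems by (cases j) auto
    then show ?thesis using False none by (simp del: filter.simps)
  qed
qed simp

lemma ht_le_length: "ht T i c \<le> int (length (T ! i))"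
  by (simp add: ht_def)

lemma ht_mono: "c \<le> d \<Longrightarrow> ht T i c \<le> ht T i d"
proof -
  assume "c \<le> d"
  then have "filter (\<lambda>x. x \<le> c + i) (T ! i) = filter (\<lambda>x. x \<le> c + i) (filter (\<lambda>x. x \<le> d + i) (T ! i))"
    by (auto intro: filter_cong)
  then show ?thesis unfolding ht_def using length_filter_le by (metis of_nat_le_iff)
qed

lemma ht_full: "(\<And>x. x \<in> set (T ! i) \<Longrightarrow> x \<le> c + i) \<Longrightarrow> ht T i c = int (length (T ! i))"
  by (simp add: ht_def)

lemma ht_gap:
  assumes "sorted (T ! i)" "j < length (T ! i)"
  shows "T ! i ! j \<le> c + i \<longleftrightarrow> int j < ht T i c"
  using nth_le_iff_less_count[OF assms] by (simp add: ht_def)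

lemma SSYT_D:
  assumes "T \<in> SSYT k n"
  shows "length T = k" "i < k \<Longrightarrow> sorted (T ! i)" "i < k \<Longrightarrow> set (T ! i) \<subseteq> {1..n}"
    "i < k \<Longrightarrow> j < k \<Longrightarrow> length (T ! i) = length (T ! j)"
    "Suc i < k \<Longrightarrow> j < length (T ! i) \<Longrightarrow> T ! i ! j < T ! Suc i ! j"
proof -
  obtain m where m: "length T = k" "\<forall>r \<in> set T. length r = m"
    "\<forall>r \<in> set T. set r \<subseteq> {1..n} \<and> sorted r"
    "\<forall>i j. Suc i < k \<longrightarrow> j < length (T ! i) \<longrightarrow> T ! i ! j < T ! Suc i ! j"
    using assms unfolding SSYT_def by blast
  show "length T = k" by (fact m(1))
  have row: "T ! i \<in> set T" if "i < k" for i using that m(1) by simp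
  show "i < k \<Longrightarrow> sorted (T ! i)" "i < k \<Longrightarrow> set (T ! i) \<subseteq> {1..n}"
    "Suc i < k \<Longrightarrow> j < length (T ! i) \<Longrightarrow> T ! i ! j < T ! Suc i ! j"
    using m(3,4) row by blast+
  show "i < k \<Longrightarrow> j < k \<Longrightarrow> length (T ! i) = length (T ! j)"
    using m(2) row by simp
qed

text \<open>If row \<open>i + 1\<close> had more entries \<open>\<le> c + i + 1\<close> than row \<open>i\<close> has entries \<open>\<le> c + i\<close>, then the column
  just past the latter would not increase strictly.\<close>
lemma ht_interlace:
  assumes T: "T \<in> SSYT k n" and i: "Suc i < k"
  shows "ht T (Suc i) c \<le> ht T i c"
proof (rule ccontr)
  assume less: "\<not> ht T (Suc i) c \<le> ht T i c"
  define j where "j = nat (ht T i c)"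
  have j: "int j = ht T i c" by (simp add: j_def ht_def)
  have sorted: "sorted (T ! i)" "sorted (T ! Suc i)" using SSYT_D(2)[OF T] i by simp_all
  have len: "length (T ! i) = length (T ! Suc i)" by (rule SSYT_D(4)[OF T]) (use i in simp_all)
  have "int j < ht T (Suc i) c" using less j by simp
  moreover from this have jl: "j < length (T ! Suc i)" using ht_le_length[of T "Suc i" c] by simp
  ultimately have "T ! Suc i ! j \<le> c + Suc i" using ht_gap[OF sorted(2)] by blast
  moreover have "T ! i ! j < T ! Suc i ! j" using SSYT_D(5)[OF T i] jl len by simp
  ultimately have "T ! i ! j \<le> c + i" by simp
  then show False using ht_gap[OF sorted(1)] jl len j by simp
qed

lemma ht_antimono:
  assumes T: "T \<in> SSYT k n" and "i \<le> j" "j < k"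
  shows "ht T j c \<le> ht T i c"
  using assms(2,3)
proof (induction j rule: dec_induct)
  case (step j)
  then show ?case using ht_interlace[OF T, of j c] by simp
qed simp

text \<open>Row \<open>0\<close> has no entry \<open>0\<close>, and this propagates downwards by \<open>ht_antimono\<close>.\<close>
lemma ht_0:
  assumes T: "T \<in> SSYT k n" and "i < k"
  shows "ht T i 0 = 0"
proof -
  have "set (T ! 0) \<subseteq> {1..n}" using SSYT_D(3)[OF T] assms(2) by (metis gr_implies_not0 gr0I)
  then have "ht T 0 0 = 0" by (auto simp: ht_def filter_empty_conv)
  moreover have "0 \<le> ht T i 0" by (simp add: ht_def)
  ultimately show ?thesis using ht_antimono[OF T, of 0 i 0] assms(2) by simp
qed

text \<open>In the bottom row every entry is at most \<open>k + l\<close>, so the count is already full for \<open>c = l + 1\<close>; this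
  propagates upwards by \<open>ht_antimono\<close>.\<close>
lemma row_length:
  assumes T: "T \<in> SSYT k (k + l)" and "i < k" "l < c"
  shows "ht T i c = int (length (T ! i))"
proof -
  have "set (T ! (k - 1)) \<subseteq> {1..k + l}" using SSYT_D(3)[OF T] assms(2) by simp
  then have "ht T (k - 1) c = int (length (T ! (k - 1)))"
    using assms(2,3) by (intro ht_full) fastforce
  also have "length (T ! (k - 1)) = length (T ! i)"
    by (rule SSYT_D(4)[OF T]) (use assms(2) in simp_all)
  finally show ?thesis
    using ht_antimono[OF T, of i "k - 1" c] ht_le_length[of T i c] assms(2) by simp
qed

lemma SSYT_profile:
  assumes T: "T \<in> SSYT k (k + l)"
  shows "profile k l (ht T)"
proof (rule profileI)
  fix i c assume "i < k" "l < c"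
  then show "ht T i c = int (length (T ! 0))"
    using row_length[OF T] SSYT_D(4)[OF T, of i 0] by simp
qed (auto intro: ht_0[OF T] ht_interlace[OF T] ht_mono)

lemma entry_gt_row:
  assumes "ht T i 0 = 0" "x \<in> set (T ! i)"
  shows "i < x"
  using assms by (force simp: ht_def filter_empty_conv)

text \<open>The converse of \<open>SSYT_profile\<close>. A large \<open>c\<close> shows that all rows have the same length, the values at
  \<open>0\<close> and \<open>l + 1\<close> bound the entries, and the inequality between adjacent rows, read at an entry of the
  lower row, gives strict increase in its column.\<close>
lemma profile_imp_SSYT:
  assumes len: "length T = k" and sorted: "\<And>i. i < k \<Longrightarrow> sorted (T ! i)"
    and p: "profile k l (ht T)"
  shows "T \<in> SSYT k (k + l)"
proof -
  define m where "m = nat (ht T 0 (Suc l))"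
  have length: "length (T ! i) = m" if i: "i < k" for i
  proof -
    \<comment> \<open>Any \<open>c > l\<close> that bounds all the entries of the row would do.\<close>
    let ?c = "Suc l + sum_list (T ! i)"
    have "ht T i ?c = int (length (T ! i))"
      by (rule ht_full) (use member_le_sum_list in fastforce)
    moreover have "ht T i ?c = ht T 0 (Suc l)" using profileD(4)[OF p, of i 0] i by simp
    ultimately show ?thesis by (simp add: m_def)
  qed
  have upper: "x \<le> k + l" if i: "i < k" and x: "x \<in> set (T ! i)" for i x
  proof -
    have "ht T i (Suc l) = int (length (T ! i))"
      using length[OF i] profileD(4)[OF p, of i 0 "Suc l" "Suc l"] i by (simp add: m_def ht_def)
    then have "x \<le> Suc l + i"
      using length_filter_less[OF x, of "\<lambda>x. x \<le> Suc l + i"] by (auto simp: ht_def)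
    then show ?thesis using i by simp
  qed
  have lower: "i < x" if "i < k" "x \<in> set (T ! i)" for i x
    using entry_gt_row profileD(1)[OF p] that by blast
  have column: "T ! i ! j < T ! Suc i ! j" if i: "Suc i < k" and j: "j < length (T ! i)" for i j
  proof -
    have j': "j < length (T ! Suc i)" using j length i by simp
    define c where "c = T ! Suc i ! j - Suc i"
    have c: "Suc i < T ! Suc i ! j" using lower[OF i] j' by simp
    then have "int j < ht T (Suc i) c" using ht_gap[of T "Suc i" j c] sorted i j' by (simp add: c_def)
    also have "\<dots> \<le> ht T i c" by (rule profileD(3)[OF p i])
    finally have "T ! i ! j \<le> c + i" using ht_gap[of T i j c] sorted i j by simp
    then show ?thesis using c by (simp add: c_def)
  qed
  have rows: "length r = m \<and> set r \<subseteq> {1..k + l} \<and> sorted r" if r: "r \<in> set T" for r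
  proof -
    obtain i where i: "i < k" "r = T ! i" using r len by (metis in_set_conv_nth)
    have "x \<in> {1..k + l}" if "x \<in> set r" for x
      using upper[OF i(1), of x] lower[OF i(1), of x] that unfolding i(2) by simp
    then show ?thesis using length[OF i(1)] sorted[OF i(1)] unfolding i(2) by blast
  qed
  show ?thesis
    unfolding SSYT_def mem_Collect_eq
    using len rows column by (intro conjI exI[where x = m] ballI allI impI) simp_all
qed

lemma ht_determines_tableau:
  assumes S: "S \<in> SSYT k (k + l)" and T: "T \<in> SSYT k (k + l)"
    and eq: "\<And>i c. i < k \<Longrightarrow> ht S i c = ht T i c"
  shows "S = T"
proof (rule nth_equalityI)
  show "length S = length T" using SSYT_D(1)[OF S] SSYT_D(1)[OF T] by simp
  fix i assume "i < length S"
  then have i: "i < k" using SSYT_D(1)[OF S] by simp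
  have len: "length (S ! i) = length (T ! i)"
    using row_length[OF S i, of "Suc l"] row_length[OF T i, of "Suc l"] eq[OF i] by simp
  have sorted: "sorted (S ! i)" "sorted (T ! i)" using SSYT_D(2)[OF S i] SSYT_D(2)[OF T i] by simp_all
  show "S ! i = T ! i"
  proof (rule nth_equalityI[OF len])
    fix j assume j: "j < length (S ! i)"
    have gt: "i < S ! i ! j" "i < T ! i ! j"
      using entry_gt_row[OF ht_0[OF S i]] entry_gt_row[OF ht_0[OF T i]] j len by auto
    have "S ! i ! j \<le> c + i \<longleftrightarrow> T ! i ! j \<le> c + i" for c
      using ht_gap[OF sorted(1) j] ht_gap[OF sorted(2), of j] j len eq[OF i] by simp
    from this[of "S ! i ! j - i"] this[of "T ! i ! j - i"] gt
    show "S ! i ! j = T ! i ! j" by simp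
  qed
qed

text \<open>The increments of \<open>h i\<close> are the multiplicities of the entries \<open>i + 1, \<dots>, i + l + 1\<close> in row \<open>i\<close>.\<close>
lemma profile_tableau:
  assumes p: "profile k l h"
  shows "\<exists>T \<in> SSYT k (k + l). \<forall>i<k. \<forall>c. ht T i c = h i c"
proof -
  define row where "row = (\<lambda>i. sorted_list_of_multiset
    (\<Sum>d<Suc l. replicate_mset (nat (h i (Suc d) - h i d)) (Suc d + i)))"
  define T where "T = map row [0..<k]"
  have ht: "ht T i c = h i c" if i: "i < k" for i c
  proof -
    have filter: "filter_mset P (\<Sum>d<n. f d) = (\<Sum>d<n. filter_mset P (f d))" for n P and f :: "nat \<Rightarrow> nat multiset"
      by (induction n) auto
    have size: "length (filter P xs) = size (filter_mset P (mset xs))" for P and xs :: "nat list"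
      by (metis mset_filter size_mset)
    have replicate: "filter_mset P (replicate_mset n x) = (if P x then replicate_mset n x else {#})"
      for P n and x :: nat by (induction n) auto
    have "ht T i c = int (size (\<Sum>d<Suc l. filter_mset (\<lambda>x. x \<le> c + i)
        (replicate_mset (nat (h i (Suc d) - h i d)) (Suc d + i))))"
      using i by (simp add: ht_def T_def size row_def filter del: sum.lessThan_Suc)
    also have "\<dots> = (\<Sum>d<Suc l. if d < c then h i (Suc d) - h i d else 0)"
    proof -
      have "int (size (filter_mset (\<lambda>x. x \<le> c + i)
          (replicate_mset (nat (h i (Suc d) - h i d)) (Suc d + i))))
          = (if d < c then h i (Suc d) - h i d else 0)" for d
        using profileD(2)[OF p i, of d "Suc d"] by (cases "d < c") (simp_all add: replicate)
      then show ?thesis by (simp only: size_multiset_sum of_nat_sum)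
    qed
    also have "\<dots> = (\<Sum>d<min c (Suc l). h i (Suc d) - h i d)"
      by (subst sum.inter_filter[symmetric]) (auto intro!: sum.cong)
    also have "\<dots> = h i (min c (Suc l)) - h i 0"
      by (rule sum_lessThan_telescope)
    also have "\<dots> = h i c"
      using profileD(1)[OF p i] profileD(4)[OF p i i, of "Suc l" c] by (auto simp: min_def)
    finally show ?thesis .
  qed
  have "T \<in> SSYT k (k + l)"
  proof (rule profile_imp_SSYT)
    show "profile k l (ht T)" by (rule profile_cong[OF p ht])
  qed (auto simp: T_def row_def)
  then show ?thesis using ht by blast
qed

lemma ht_tableau_union:
  assumes "i < length S" "length T = length S"
  shows "ht (tableau_union S T) i c = ht S i c + ht T i c"
proof -
  have size: "length (filter P xs) = size (filter_mset P (mset xs))" for P and xs :: "nat list"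
    by (metis mset_filter size_mset)
  show ?thesis using assms by (simp add: ht_def tableau_union_def size)
qed

lemma ht_union_SSYT:
  assumes "S \<in> SSYT k n" "T \<in> SSYT k n" "i < k"
  shows "ht (tableau_union S T) i c = ht S i c + ht T i c"
  using assms by (intro ht_tableau_union) (simp_all add: SSYT_D(1))

lemma tableau_union_SSYT:
  assumes S: "S \<in> SSYT k (k + l)" and T: "T \<in> SSYT k (k + l)"
  shows "tableau_union S T \<in> SSYT k (k + l)"
proof (rule profile_imp_SSYT)
  show "length (tableau_union S T) = k"
    using SSYT_D(1)[OF S] SSYT_D(1)[OF T] by (simp add: tableau_union_def)
  show "sorted (tableau_union S T ! i)" if "i < k" for i
    using that SSYT_D(1)[OF S] SSYT_D(1)[OF T] by (simp add: tableau_union_def)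
  show "profile k l (ht (tableau_union S T))"
    by (rule profile_cong[OF profile_add[OF SSYT_profile[OF S] SSYT_profile[OF T]] ht_union_SSYT[OF S T]])
qed

lemma ht_empty_tableau: "i < k \<Longrightarrow> ht (empty_tableau k) i c = 0"
  by (simp add: ht_def empty_tableau_def)

lemma empty_tableau_SSYT: "empty_tableau k \<in> SSYT k n"
  by (auto simp: SSYT_def empty_tableau_def)


section \<open>Trivial factors\<close>

text \<open>A complement of \<open>S\<close> in \<open>T\<close> must have the difference of the two profiles, and tableaux are determined by
  their profiles.\<close>
lemma tableau_factor_iff:
  assumes S: "S \<in> SSYT k (k + l)" and T: "T \<in> SSYT k (k + l)"
  shows "tableau_factor k (k + l) S T \<longleftrightarrow> profile k l (\<lambda>i c. ht T i c - ht S i c)"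
proof
  assume "tableau_factor k (k + l) S T"
  then obtain U where U: "U \<in> SSYT k (k + l)" "T = tableau_union S U"
    by (auto simp: tableau_factor_def)
  then have "ht T i c - ht S i c = ht U i c" if "i < k" for i c
    using ht_union_SSYT[OF S U(1) that] by simp
  then show "profile k l (\<lambda>i c. ht T i c - ht S i c)"
    by (rule profile_cong[OF SSYT_profile[OF U(1)]])
next
  assume "profile k l (\<lambda>i c. ht T i c - ht S i c)"
  then obtain U where U: "U \<in> SSYT k (k + l)" "\<And>i c. i < k \<Longrightarrow> ht U i c = ht T i c - ht S i c"
    using profile_tableau by blast
  then have "T = tableau_union S U"
    by (intro ht_determines_tableau[OF T tableau_union_SSYT[OF S U(1)]])
       (simp add: ht_union_SSYT[OF S U(1)])
  then show "tableau_factor k (k + l) S T" using S U(1) by (auto simp: tableau_factor_def)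
qed

lemma trivial_tableau_iff:
  assumes T: "T \<in> SSYT k (k + l)"
  shows "trivial_tableau T \<longleftrightarrow> (\<forall>i c. i < k \<longrightarrow> ht T i c = ht T 0 c)"
proof
  assume triv: "trivial_tableau T"
  have step: "ht T (Suc i) c = ht T i c" if i: "Suc i < k" for i c
  proof -
    have "T ! Suc i = map Suc (T ! i)"
      using triv i SSYT_D(1)[OF T] SSYT_D(4)[OF T, of "Suc i" i]
      by (intro nth_equalityI) (auto simp: trivial_tableau_def)
    then show ?thesis by (simp add: ht_def filter_map comp_def)
  qed
  have "ht T i c = ht T 0 c" if "i < k" for i c
    using that by (induction i) (auto simp: step)
  then show "\<forall>i c. i < k \<longrightarrow> ht T i c = ht T 0 c" by blast
next
  assume eq: "\<forall>i c. i < k \<longrightarrow> ht T i c = ht T 0 c"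
  show "trivial_tableau T"
    unfolding trivial_tableau_def
  proof (intro allI impI)
    fix i j assume "Suc i < length T" and j: "j < length (T ! i)"
    then have i: "Suc i < k" using SSYT_D(1)[OF T] by simp
    have j': "j < length (T ! Suc i)" using SSYT_D(4)[OF T, of i "Suc i"] i j by simp
    have gt: "i < T ! i ! j" using entry_gt_row[OF ht_0[OF T]] i j by simp
    define c where "c = T ! i ! j - i"
    have "int j < ht T i c"
      using ht_gap[of T i j c] SSYT_D(2)[OF T, of i] i j gt by (simp add: c_def)
    also have "ht T i c = ht T (Suc i) c" using eq i by (metis Suc_lessD)
    finally have "T ! Suc i ! j \<le> c + Suc i"
      using ht_gap[of T "Suc i" j c] SSYT_D(2)[OF T, of "Suc i"] i j' by simp
    then show "T ! Suc i ! j = T ! i ! j + 1"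
      using SSYT_D(5)[OF T i j] gt by (simp add: c_def)
  qed
qed

text \<open>The profile, common to all rows, of the maximal trivial factor of a tableau with profile \<open>h\<close>: a
  trivial factor can use at most \<open>h i (Suc d) - h i d\<close> copies of the entry \<open>d + i + 1\<close> in row \<open>i\<close>.\<close>
definition trivial_part :: "nat \<Rightarrow> (nat \<Rightarrow> nat \<Rightarrow> int) \<Rightarrow> nat \<Rightarrow> int" where
  "trivial_part k h c = (\<Sum>d<c. Min ((\<lambda>i. h i (Suc d) - h i d) ` {..<k}))"

lemma trivial_part_Suc:
  "trivial_part k h (Suc c) = trivial_part k h c + Min ((\<lambda>i. h i (Suc c) - h i c) ` {..<k})"
  by (simp add: trivial_part_def)

lemma trivial_part_0 [simp]: "trivial_part k h 0 = 0"
  by (simp add: trivial_part_def)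

lemma trivial_part_increment_le:
  "i < k \<Longrightarrow> trivial_part k h (Suc c) - trivial_part k h c \<le> h i (Suc c) - h i c"
  by (simp add: trivial_part_Suc)

lemma trivial_part_increment_greatest:
  assumes "0 < k" "\<And>i. i < k \<Longrightarrow> a \<le> h i (Suc c) - h i c"
  shows "a \<le> trivial_part k h (Suc c) - trivial_part k h c"
proof -
  have "a \<le> Min ((\<lambda>i. h i (Suc c) - h i c) ` {..<k})"
    using assms by (intro Min.boundedI) auto
  then show ?thesis by (simp add: trivial_part_Suc)
qed

text \<open>Adding the same function of \<open>c\<close> to all the rows moves every increment, hence also the minimal one, by the
  increment of that function.\<close>
lemma trivial_part_shift:
  assumes "0 < k" "\<And>i c. i < k \<Longrightarrow> g i c = h i c + d c"
  shows "trivial_part k g c = trivial_part k h c + d c - d 0"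
proof (induction c)
  case (Suc c)
  have "(\<lambda>i. g i (Suc c) - g i c) ` {..<k} = (\<lambda>i. (h i (Suc c) - h i c) + (d (Suc c) - d c)) ` {..<k}"
    using assms(2) by (intro image_cong) auto
  moreover have "Min ((\<lambda>i. (h i (Suc c) - h i c) + (d (Suc c) - d c)) ` {..<k})
      = Min ((\<lambda>i. h i (Suc c) - h i c) ` {..<k}) + (d (Suc c) - d c)"
    using assms(1) by (intro Min_add_commute) auto
  ultimately show ?case using Suc by (simp add: trivial_part_Suc)
qed simp

lemma trivial_part_const:
  assumes p: "profile k l h" and k: "0 < k" and "l < c"
  shows "trivial_part k h c = trivial_part k h (Suc l)"
  using \<open>l < c\<close>
proof (induction c rule: less_induct)
  case (less c)
  show ?case
  proof (cases "c = Suc l")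
    case False
    then obtain b where b: "c = Suc b" "l < b" using less.prems by (cases c) auto
    have "(\<lambda>i. h i (Suc b) - h i b) ` {..<k} = {0}"
      using profileD(4)[OF p, of _ _ "Suc b" b] b k by auto
    then show ?thesis using less.IH[of b] b by (simp add: trivial_part_Suc)
  qed simp
qed

lemma profile_trivial_part:
  assumes p: "profile k l h" and k: "0 < k"
  shows "profile k l (\<lambda>i. trivial_part k h)"
proof (rule profileI)
  show "trivial_part k h c \<le> trivial_part k h (Suc c)" for c
    using trivial_part_increment_greatest[OF k, of 0 h c] profileD(2)[OF p, of _ c "Suc c"] by simp
  show "trivial_part k h c = trivial_part k h (Suc l)" if "l < c" for c
    by (rule trivial_part_const[OF p k that])
qed simp_all

lemma profile_minus_trivial_part:
  assumes p: "profile k l h" and k: "0 < k"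
  shows "profile k l (\<lambda>i c. h i c - trivial_part k h c)"
proof (rule profileI)
  show "h i c - trivial_part k h c \<le> h i (Suc c) - trivial_part k h (Suc c)" if "i < k" for i c
    using trivial_part_increment_le[OF that, of h c] by simp
  show "h i c - trivial_part k h c = h 0 (Suc l) - trivial_part k h (Suc l)" if "i < k" "l < c" for i c
    using trivial_part_const[OF p k that(2)] profileD(4)[OF p that(1) k that(2), of "Suc l"] by simp
  show "h i 0 - trivial_part k h 0 = 0" if "i < k" for i using profileD(1)[OF p that] by simp
  show "h (Suc i) c - trivial_part k h c \<le> h i c - trivial_part k h c" if "Suc i < k" for i c
    using profileD(3)[OF p that] by simp
qed

text \<open>The tableau \<open>S0\<close> with profile \<^const>\<open>trivial_part\<close> is a trivial factor of \<open>T\<close>, and every trivial factor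
  of \<open>T\<close> is a factor of \<open>S0\<close>, since its increments are bounded by those of every row of \<open>T\<close>. As the
  factor relation is antisymmetric, \<open>S0\<close> is the only maximal one.\<close>
lemma maximal_trivial_factor_iff:
  assumes T: "T \<in> SSYT k (k + l)" and k: "0 < k"
  shows "maximal_trivial_factor k (k + l) S T \<longleftrightarrow>
    S \<in> SSYT k (k + l) \<and> (\<forall>i c. i < k \<longrightarrow> ht S i c = trivial_part k (ht T) c)"
proof -
  let ?n = "k + l" and ?t = "trivial_part k (ht T)"
  note p = SSYT_profile[OF T]
  obtain S0 where S0: "S0 \<in> SSYT k ?n" "\<And>i c. i < k \<Longrightarrow> ht S0 i c = ?t c"
    using profile_tableau[OF profile_trivial_part[OF p k]] by blast
  have "profile k l (\<lambda>i c. ht T i c - ht S0 i c)"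
    by (rule profile_cong[OF profile_minus_trivial_part[OF p k]]) (simp add: S0(2))
  then have factor: "tableau_factor k ?n S0 T" using tableau_factor_iff[OF S0(1) T] by simp
  have trivial: "trivial_tableau S0"
    using trivial_tableau_iff[OF S0(1)] S0(2) k by simp
  have greatest: "tableau_factor k ?n S' S0" if f: "tableau_factor k ?n S' T" and "trivial_tableau S'" for S'
  proof -
    have S': "S' \<in> SSYT k ?n" using f by (simp add: tableau_factor_def)
    note p' = SSYT_profile[OF S']
    have q: "profile k l (\<lambda>i c. ht T i c - ht S' i c)" using f tableau_factor_iff[OF S' T] by simp
    have const: "ht S' i c = ht S' 0 c" if "i < k" for i c
      using \<open>trivial_tableau S'\<close> trivial_tableau_iff[OF S'] that by blast
    have "ht S' 0 (Suc c) - ht S' 0 c \<le> ?t (Suc c) - ?t c" for c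
    proof (rule trivial_part_increment_greatest[OF k])
      fix i assume "i < k"
      then show "ht S' 0 (Suc c) - ht S' 0 c \<le> ht T i (Suc c) - ht T i c"
        using profileD(2)[OF q, of i c "Suc c"] const[of i c] const[of i "Suc c"] by simp
    qed
    then have "profile k l (\<lambda>i c. ?t c - ht S' 0 c)"
    proof (intro profileI)
      show "?t 0 - ht S' 0 0 = 0" using ht_0[OF S' k] by simp
      show "?t c - ht S' 0 c = ?t (Suc l) - ht S' 0 (Suc l)" if "l < c" for c
        using trivial_part_const[OF p k that] profileD(4)[OF p' k k that, of "Suc l"] by simp
    qed (simp_all add: algebra_simps)
    then have "profile k l (\<lambda>i c. ht S0 i c - ht S' i c)"
      by (rule profile_cong) (use S0(2) const in metis)
    then show ?thesis using tableau_factor_iff[OF S' S0(1)] by simp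
  qed
  have antisym: "A = B" if AB: "tableau_factor k ?n A B" "tableau_factor k ?n B A" for A B
  proof -
    have A: "A \<in> SSYT k ?n" and B: "B \<in> SSYT k ?n" using AB by (auto simp: tableau_factor_def)
    have le: "ht A i c \<le> ht B i c"
      if A: "A \<in> SSYT k ?n" and B: "B \<in> SSYT k ?n" and "tableau_factor k ?n A B" and i: "i < k" for A B i c
    proof -
      have q: "profile k l (\<lambda>i c. ht B i c - ht A i c)" using that tableau_factor_iff[OF A B] by simp
      show ?thesis using profileD(1)[OF q i] profileD(2)[OF q i, of 0 c] by simp
    qed
    show ?thesis
      by (rule ht_determines_tableau[OF A B]) (simp add: le[OF A B AB(1)] le[OF B A AB(2)] order_antisym)
  qed
  have "maximal_trivial_factor k ?n S T \<longleftrightarrow> S = S0"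
    unfolding maximal_trivial_factor_def using factor trivial greatest antisym by blast
  also have "\<dots> \<longleftrightarrow> S \<in> SSYT k ?n \<and> (\<forall>i c. i < k \<longrightarrow> ht S i c = ?t c)"
    using S0 ht_determines_tableau[OF _ S0(1), of S] by auto
  finally show ?thesis .
qed

lemma reduced_tableau:
  assumes T: "T \<in> SSYT k (k + l)" and k: "0 < k"
  shows "reduced_tableau k (k + l) T \<in> SSYT k (k + l)"
    and "i < k \<Longrightarrow> ht (reduced_tableau k (k + l) T) i c = ht T i c - trivial_part k (ht T) c"
proof -
  let ?n = "k + l" and ?t = "trivial_part k (ht T)"
  note p = SSYT_profile[OF T]
  obtain S where S: "S \<in> SSYT k ?n" "\<And>i c. i < k \<Longrightarrow> ht S i c = ?t c"
    using profile_tableau[OF profile_trivial_part[OF p k]] by blast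
  obtain U where U: "U \<in> SSYT k ?n" "\<And>i c. i < k \<Longrightarrow> ht U i c = ht T i c - ?t c"
    using profile_tableau[OF profile_minus_trivial_part[OF p k]] by blast
  have "reduced_tableau k ?n T = U"
    unfolding reduced_tableau_def
  proof (rule the_equality)
    have "T = tableau_union S U"
      by (rule ht_determines_tableau[OF T tableau_union_SSYT[OF S(1) U(1)]])
         (simp add: ht_union_SSYT[OF S(1) U(1)] S(2) U(2))
    then show "U \<in> SSYT k ?n \<and> (\<exists>S. maximal_trivial_factor k ?n S T \<and> T = tableau_union S U)"
      using U(1) S maximal_trivial_factor_iff[OF T k] by blast
  next
    fix V assume "V \<in> SSYT k ?n \<and> (\<exists>S. maximal_trivial_factor k ?n S T \<and> T = tableau_union S V)"
    then obtain S' where V: "V \<in> SSYT k ?n" and S': "maximal_trivial_factor k ?n S' T" "T = tableau_union S' V"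
      by blast
    have S'': "S' \<in> SSYT k ?n" "\<And>i c. i < k \<Longrightarrow> ht S' i c = ?t c"
      using S'(1) maximal_trivial_factor_iff[OF T k] by blast+
    have "ht V i c = ht U i c" if "i < k" for i c
      using ht_union_SSYT[OF S''(1) V that, of c] S'(2) S''(2)[OF that] U(2)[OF that] by simp
    then show "V = U" by (rule ht_determines_tableau[OF V U(1)])
  qed
  then show "reduced_tableau k ?n T \<in> SSYT k ?n"
    and "i < k \<Longrightarrow> ht (reduced_tableau k ?n T) i c = ht T i c - ?t c"
    using U by simp_all
qed


section \<open>Tableaux up to trivial factors\<close>

lemma free_indices_cases:
  assumes "x \<in> free_indices k l"
  obtains i c where "x = (Suc i, 2 * int c + xi (Suc i))" "Suc i < k" "c < l"
proof -
  obtain i r where x: "x = (i, r)" and i: "1 \<le> i" "i \<le> k - 1" and r: "0 \<le> r" "r < 2 * int l" "r mod 2 = xi i"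
    using assms by (auto simp: free_indices_def vertices_def)
  have "r = 2 * (r div 2) + r mod 2" by simp
  then have "x = (Suc (i - 1), 2 * int (nat (r div 2)) + xi (Suc (i - 1)))"
    using x r i by simp
  moreover have "Suc (i - 1) < k" "nat (r div 2) < l" using i r by auto
  ultimately show ?thesis by (rule that)
qed

lemma free_indexI:
  assumes "Suc i < k" "c < l"
  shows "(Suc i, 2 * int c + xi (Suc i)) \<in> free_indices k l"
  using assms by (auto simp: free_indices_def vertices_def xi_def)

lemma finite_free_indices: "finite (free_indices k l)"
  by (rule finite_subset[of _ "vertices k \<times> {0..<2 * int l}"]) (auto simp: free_indices_def vertices_def)

text \<open>The index \<open>(i, r)\<close> with \<open>r = 2c + \<xi>\<^sub>i\<close> holds the difference between the rows \<open>i - 1\<close> and \<open>i\<close> at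
  \<open>c + 1\<close>. Rows are numbered from \<open>0\<close> and vertices from \<open>1\<close>, hence the predecessor; \<open>r div 2\<close> is \<open>c\<close> for
  both values of \<open>\<xi>\<^sub>i\<close>.\<close>
definition coords :: "nat \<Rightarrow> nat \<Rightarrow> tableau \<Rightarrow> ((nat \<times> int) \<Rightarrow>\<^sub>0 int)" where
  "coords k l T = Abs_poly_mapping (\<lambda>(i, r). if (i, r) \<in> free_indices k l
     then ht T (i - 1) (Suc (nat (r div 2))) - ht T i (Suc (nat (r div 2))) else 0)"

lemma lookup_coords:
  "Poly_Mapping.lookup (coords k l T) (i, r) = (if (i, r) \<in> free_indices k l
     then ht T (i - 1) (Suc (nat (r div 2))) - ht T i (Suc (nat (r div 2))) else 0)"
  unfolding coords_def
  by (subst lookup_Abs_poly_mapping)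
     (auto intro: finite_subset[OF _ finite_free_indices[of k l]] split: if_splits)

lemma lookup_coords_outside: "x \<notin> free_indices k l \<Longrightarrow> Poly_Mapping.lookup (coords k l T) x = 0"
  by (cases x) (simp add: lookup_coords)

lemma lookup_coords_index:
  assumes "Suc i < k" "c < l"
  shows "Poly_Mapping.lookup (coords k l T) (Suc i, 2 * int c + xi (Suc i))
    = ht T i (Suc c) - ht T (Suc i) (Suc c)"
proof -
  have "(2 * int c + xi (Suc i)) div 2 = int c" by (simp add: xi_def)
  then show ?thesis using free_indexI[OF assms] by (simp add: lookup_coords)
qed

lemma coords_eqI:
  assumes "\<And>x. x \<notin> free_indices k l \<Longrightarrow> Poly_Mapping.lookup y x = 0"
    and "\<And>i c. Suc i < k \<Longrightarrow> c < l \<Longrightarrow>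
      ht T i (Suc c) - ht T (Suc i) (Suc c) = Poly_Mapping.lookup y (Suc i, 2 * int c + xi (Suc i))"
  shows "coords k l T = y"
proof (rule poly_mapping_eqI)
  fix x
  show "Poly_Mapping.lookup (coords k l T) x = Poly_Mapping.lookup y x"
  proof (cases "x \<in> free_indices k l")
    case True
    then show ?thesis
      by (rule free_indices_cases) (simp add: lookup_coords_index assms(2))
  qed (simp add: assms(1) lookup_coords_outside)
qed

lemma coords_in_free_comm_monoid:
  assumes T: "T \<in> SSYT k n"
  shows "coords k l T \<in> carrier (free_comm_monoid (free_indices k l))"
  unfolding mem_free_comm_monoid
proof (intro allI conjI impI)
  fix x
  show "0 \<le> Poly_Mapping.lookup (coords k l T) x"
  proof (cases "x \<in> free_indices k l")
    case True
    then show ?thesis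
      by (rule free_indices_cases) (simp add: lookup_coords_index ht_interlace[OF T])
  qed (simp add: lookup_coords_outside)
qed (simp add: lookup_coords_outside)

lemma coords_tableau_union:
  assumes "S \<in> SSYT k n" "T \<in> SSYT k n"
  shows "coords k l (tableau_union S T) = coords k l S + coords k l T"
  by (rule coords_eqI) (auto simp: lookup_add lookup_coords_outside lookup_coords_index ht_union_SSYT[OF assms])

lemma coords_empty_tableau: "coords k l (empty_tableau k) = 0"
  by (rule coords_eqI) (auto simp: ht_empty_tableau)

text \<open>The coordinates record the differences only for \<open>1 \<le> c \<le> l\<close>, but outside this range all rows agree.\<close>
lemma coords_eq_iff:
  assumes S: "S \<in> SSYT k (k + l)" and T: "T \<in> SSYT k (k + l)"
  shows "coords k l S = coords k l T \<longleftrightarrow>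
    (\<forall>i c. Suc i < k \<longrightarrow> ht S i c - ht S (Suc i) c = ht T i c - ht T (Suc i) c)" (is "?L \<longleftrightarrow> ?R")
proof
  assume eq: ?L
  show ?R
  proof (intro allI impI)
    fix i c assume i: "Suc i < k"
    consider "c = 0" | "l < c" | b where "c = Suc b" "b < l" by (cases c) force+
    then show "ht S i c - ht S (Suc i) c = ht T i c - ht T (Suc i) c"
    proof cases
      case 1
      then show ?thesis using i by (simp add: ht_0[OF S] ht_0[OF T])
    next
      case 2
      then show ?thesis
        using i profileD(4)[OF SSYT_profile[OF S], of i "Suc i" c c]
          profileD(4)[OF SSYT_profile[OF T], of i "Suc i" c c] by simp
    next
      case 3
      then show ?thesis using eq i lookup_coords_index[of i k b l] by metis
    qed
  qed
next
  assume ?R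
  then show ?L
    by (intro coords_eqI) (simp_all add: lookup_coords_outside lookup_coords_index)
qed

text \<open>The function \<open>e\<close> realises the prescribed differences by adding them up from the bottom row. It need not
  be monotone in \<open>c\<close>, but it takes values between \<open>0\<close> and the total \<open>K\<close> of all coordinates, so adding
  the slope \<open>K\<close> to every row repairs this without affecting the differences.\<close>
lemma coords_surj:
  assumes y: "y \<in> carrier (free_comm_monoid (free_indices k l))"
  shows "y \<in> coords k l ` SSYT k (k + l)"
proof -
  define \<delta> where "\<delta> = (\<lambda>i c. Poly_Mapping.lookup y (Suc i, 2 * int c + xi (Suc i)))"
  define e where "e = (\<lambda>i c. if 1 \<le> c \<and> c \<le> l then \<Sum>j=i..<k-1. \<delta> j (c - 1) else 0)"
  define K where "K = (\<Sum>c<l. \<Sum>j<k-1. \<delta> j c)"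
  define h where "h = (\<lambda>i c. K * int (min c (Suc l)) + e i c)"
  have \<delta>: "0 \<le> \<delta> i c" for i c using y by (simp add: \<delta>_def mem_free_comm_monoid)
  then have K0: "0 \<le> K" by (simp add: K_def sum_nonneg)
  have e0: "0 \<le> e i c" for i c by (simp add: e_def sum_nonneg \<delta>)
  have eK: "e i c \<le> K" for i c
  proof (cases "1 \<le> c \<and> c \<le> l")
    case True
    then have "e i c \<le> (\<Sum>j<k-1. \<delta> j (c - 1))"
      unfolding e_def by (auto intro!: sum_mono2 \<delta>)
    also have "\<dots> \<le> K"
      unfolding K_def using True
      by (intro member_le_sum[where f = "\<lambda>c. \<Sum>j<k-1. \<delta> j c" and i = "c - 1"]) (auto intro: sum_nonneg \<delta>)
    finally show ?thesis .
  qed (use K0 in \<open>auto simp: e_def\<close>)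
  have e_step: "e i (Suc c) = e (Suc i) (Suc c) + \<delta> i c" if "Suc i < k" "c < l" for i c
  proof -
    have "{i..<k-1} = insert i {Suc i..<k-1}" using that by auto
    then show ?thesis using that by (simp add: e_def)
  qed
  have "profile k l h"
  proof (rule profileI)
    show "h i 0 = 0" for i by (simp add: h_def e_def)
    show "h i c \<le> h i (Suc c)" for i c
    proof (cases "c \<le> l")
      case True
      then have "h i (Suc c) = K * int c + K + e i (Suc c)" "h i c = K * int c + e i c"
        by (auto simp: h_def algebra_simps)
      then show ?thesis using eK[of i c] e0[of i "Suc c"] by linarith
    qed (simp add: h_def e_def)
    show "h (Suc i) c \<le> h i c" if "Suc i < k" for i c
    proof (cases "1 \<le> c \<and> c \<le> l")
      case True
      then have "c - 1 < l" "Suc (c - 1) = c" by auto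
      then show ?thesis using e_step[OF that, of "c - 1"] \<delta>[of i "c - 1"] by (simp add: h_def)
    qed (auto simp: h_def e_def)
    show "h i c = K * int (Suc l)" if "l < c" for i c
      using that by (simp add: h_def e_def)
  qed
  then obtain T where T: "T \<in> SSYT k (k + l)" "\<And>i c. i < k \<Longrightarrow> ht T i c = h i c"
    using profile_tableau by blast
  have "coords k l T = y"
  proof (rule coords_eqI)
    show "Poly_Mapping.lookup y x = 0" if "x \<notin> free_indices k l" for x
      using y that unfolding mem_free_comm_monoid by blast
    show "ht T i (Suc c) - ht T (Suc i) (Suc c) = Poly_Mapping.lookup y (Suc i, 2 * int c + xi (Suc i))"
      if "Suc i < k" "c < l" for i c
      using e_step[OF that] that by (simp add: T(2) h_def \<delta>_def)
  qed
  then show ?thesis using T(1) by blast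
qed

text \<open>Removing the trivial part subtracts the same function from every row, so \<open>S \<sim> T\<close> implies equal
  differences. Conversely, equal differences make the profiles of \<open>S\<close> and \<open>T\<close> differ by a function \<open>d\<close> of
  \<open>c\<close> alone; by \<open>trivial_part_shift\<close> their trivial parts differ by \<open>d\<close> too, so the reduced profiles
  agree.\<close>
lemma tableau_equiv_kernel:
  assumes k: "0 < k"
  shows "tableau_equiv k (k + l) =
    {(S, T). S \<in> SSYT k (k + l) \<and> T \<in> SSYT k (k + l) \<and> coords k l S = coords k l T}"
proof -
  have "reduced_tableau k (k + l) S = reduced_tableau k (k + l) T \<longleftrightarrow> coords k l S = coords k l T"
    if S: "S \<in> SSYT k (k + l)" and T: "T \<in> SSYT k (k + l)" for S T
  proof
    assume eq: "reduced_tableau k (k + l) S = reduced_tableau k (k + l) T"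
    have red: "ht S i c - trivial_part k (ht S) c = ht T i c - trivial_part k (ht T) c" if "i < k" for i c
      using reduced_tableau(2)[OF S k that] reduced_tableau(2)[OF T k that] eq by simp
    show "coords k l S = coords k l T"
      unfolding coords_eq_iff[OF S T]
    proof (intro allI impI)
      fix i c assume "Suc i < k"
      then show "ht S i c - ht S (Suc i) c = ht T i c - ht T (Suc i) c"
        using red[of i c] red[of "Suc i" c] by simp
    qed
  next
    assume "coords k l S = coords k l T"
    then have step: "ht S i c - ht S (Suc i) c = ht T i c - ht T (Suc i) c" if "Suc i < k" for i c
      using that coords_eq_iff[OF S T] by blast
    define d where "d = (\<lambda>c. ht S 0 c - ht T 0 c)"
    have shift: "ht S i c = ht T i c + d c" if "i < k" for i c
      using that
    proof (induction i)
      case (Suc i)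
      then show ?case using step[of i c] by simp
    qed (simp add: d_def)
    have "d 0 = 0" using ht_0[OF S k] ht_0[OF T k] by (simp add: d_def)
    then have "trivial_part k (ht S) c = trivial_part k (ht T) c + d c" for c
      using trivial_part_shift[where g = "ht S" and h = "ht T" and d = d, OF k shift] by simp
    then show "reduced_tableau k (k + l) S = reduced_tableau k (k + l) T"
      by (intro ht_determines_tableau[OF reduced_tableau(1)[OF S k] reduced_tableau(1)[OF T k]])
         (simp add: reduced_tableau(2)[OF S k] reduced_tableau(2)[OF T k] shift)
  qed
  then show ?thesis by (auto simp: tableau_equiv_def)
qed

lemma SSYT_classes_free:
  assumes k: "0 < k"
  obtains h where "h \<in> iso (SSYT_classes k (k + l)) (free_comm_monoid (free_indices k l))"
    and "comm_monoid (SSYT_classes k (k + l))"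
proof -
  let ?M = "SSYT_monoid k (k + l)" and ?N = "free_comm_monoid (free_indices k l)"
  have M: "carrier ?M = SSYT k (k + l)" "x \<otimes>\<^bsub>?M\<^esub> y = tableau_union x y" "\<one>\<^bsub>?M\<^esub> = empty_tableau k" for x y
    by (simp_all add: SSYT_monoid_def)
  have hom: "coords k l \<in> hom ?M ?N"
    by (auto simp: hom_def M coords_in_free_comm_monoid coords_tableau_union)
  have image: "coords k l ` carrier ?M = carrier ?N"
    unfolding M using coords_in_free_comm_monoid coords_surj by blast
  have kernel: "tableau_equiv k (k + l) =
      {(S, T). S \<in> carrier ?M \<and> T \<in> carrier ?M \<and> coords k l S = coords k l T}"
    unfolding M by (rule tableau_equiv_kernel[OF k])
  have one: "\<one>\<^bsub>?M\<^esub> \<in> carrier ?M" "coords k l \<one>\<^bsub>?M\<^esub> = \<one>\<^bsub>?N\<^esub>"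
    by (simp_all add: M empty_tableau_SSYT coords_empty_tableau)
  have closed: "x \<otimes>\<^bsub>?M\<^esub> y \<in> carrier ?M" if "x \<in> carrier ?M" "y \<in> carrier ?M" for x y
    using that unfolding M by (rule tableau_union_SSYT)
  show ?thesis
    using quotient_by_kernel[OF comm_monoid_free_comm_monoid closed one hom image kernel] that
    unfolding SSYT_classes_def by blast
qed

theorem theorem3p3:
  fixes k l :: nat and \<epsilon> :: complex
  assumes "k \<ge> 2" and "l \<ge> 2" and "\<epsilon> ^ (2 * l) = 1"
  shows "comm_monoid (dominant_monomials_eps_xi k l) \<and>
         comm_monoid (SSYT_classes k (k + l)) \<and>
         dominant_monomials_eps_xi k l \<cong> SSYT_classes k (k + l)"
proof -
  have "0 < k" "0 < l" using assms by simp_all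
  obtain f where "f \<in> iso (dominant_monomials_eps_xi k l) (free_comm_monoid (free_indices k l))"
    and "comm_monoid (dominant_monomials_eps_xi k l)"
    using dominant_monomials_eps_xi_free[OF \<open>0 < l\<close>] .
  moreover obtain g where "g \<in> iso (SSYT_classes k (k + l)) (free_comm_monoid (free_indices k l))"
    and "comm_monoid (SSYT_classes k (k + l))"
    using SSYT_classes_free[OF \<open>0 < k\<close>] .
  ultimately show ?thesis using is_iso_common_target by blast
qed

end
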